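(* Let $\Bbbk$ be a field of characteristic zero. Let $\mathbf f=\gamma_1f_1(x)g_1(y)$ and $\mathbf g=\gamma_2f_2(x)g_2(y)$ where $\gamma_1,\gamma_2\in\Bbbk^\times$, $f_1,f_2\in\Bbbk[x]$ and $g_1,g_2\in\Bbbk[y]$. Assume that $f_1,f_2,g_1,g_2$ are monic, squarefree, split over $\Bbbk$, and have degrees $\ge3$. If $K\{\mathbf f\}\cong K\{\mathbf g\}$ as Poisson fields, then there exist $c_1,c_2\in\Bbbk$ and $\begin{pmatrix}c_{11}&c_{12}\\c_{21}&c_{22}\end{pmatrix}\in GL_2(\Bbbk)$ such that $$\mathbf g=\frac{\mathbf f(c_{11}x+c_{12}y+c_1,\;c_{21}x+c_{22}y+c_2)}{c_{11}c_{22}-c_{12}c_{21}}.$$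
   Context: For $\mathbf f\in\Bbbk(x,y)$, $K\{\mathbf f\}$ denotes the rational function field $\Bbbk(x,y)$ equipped with the unique ($\Bbbk$-bilinear) Poisson bracket such that $\{x,y\}=\mathbf f$; explicitly $\{g,h\}=\left(\frac{\partial g}{\partial x}\frac{\partial h}{\partial y}-\frac{\partial g}{\partial y}\frac{\partial h}{\partial x}\right)\mathbf f$. Isomorphisms of Poisson fields are $\Bbbk$-algebra isomorphisms preserving the Poisson brackets. *)

theory Defs
  imports
    "HOL-Analysis.Determinants"
    "HOL-Computational_Algebra.Polynomial_Factorial"
    "HOL-Computational_Algebra.Squarefree"
begin

text \<open>
  Polynomials in \<open>x\<close> and \<open>y\<close> are represented as polynomials in \<open>y\<close> over the polynomials in \<open>x\<close>:
  in the type \<open>'a poly poly\<close> the inner variable is \<open>x\<close>, the outer one is \<open>y\<close>.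
\<close>

type_synonym 'a bivar = "'a poly poly"
type_synonym 'a ratfun = "'a poly poly fract"

definition scalar :: "'a::field \<Rightarrow> 'a ratfun" where
  "scalar c = to_fract [:[:c:]:]"

definition varX :: "'a::field ratfun" where
  "varX = to_fract [:[:0, 1:]:]"

definition varY :: "'a::field ratfun" where
  "varY = to_fract [:0, 1:]"

definition in_x :: "'a::field poly \<Rightarrow> 'a bivar" where
  "in_x p = [:p:]"

definition in_y :: "'a::field poly \<Rightarrow> 'a bivar" where
  "in_y p = map_poly (\<lambda>c. [:c:]) p"

definition eval2 :: "'a::field bivar \<Rightarrow> 'a ratfun \<Rightarrow> 'a ratfun \<Rightarrow> 'a ratfun" where
  "eval2 p u v = poly (map_poly (\<lambda>q. poly (map_poly scalar q) u) p) v"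

abbreviation pderiv_x :: "'a::field bivar \<Rightarrow> 'a bivar" where
  "pderiv_x \<equiv> map_poly pderiv"

abbreviation pderiv_y :: "'a::field bivar \<Rightarrow> 'a bivar" where
  "pderiv_y \<equiv> pderiv"

lemma pderiv_sum: "pderiv (sum f A) = (\<Sum>i\<in>A. pderiv (f i))"
  using higher_pderiv_sum[of 1 f A] by simp

lemma pderiv_x_add: "pderiv_x (p + q) = pderiv_x p + pderiv_x q"
  by (rule poly_eqI) (simp add: coeff_map_poly pderiv_add)

lemma pderiv_x_mult: "pderiv_x (p * q) = p * pderiv_x q + q * pderiv_x p"
proof (rule poly_eqI)
  fix n
  have "coeff (pderiv_x p * q) n = (\<Sum>i\<le>n. coeff q (n - i) * pderiv (coeff p i))"
    unfolding coeff_mult by (simp add: coeff_map_poly mult.commute)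
  then show "coeff (pderiv_x (p * q)) n = coeff (p * pderiv_x q + q * pderiv_x p) n"
    by (simp add: coeff_map_poly coeff_mult pderiv_sum pderiv_mult sum.distrib
          mult.commute[of q])
qed

lemma pderiv_x_1: "pderiv_x 1 = 0"
  by (simp add: one_pCons map_poly_pCons pderiv_pCons)

lemma quotient_rule_well_defined:
  fixes D :: "'b::idom \<Rightarrow> 'b"
  assumes D: "\<And>p q. D (p * q) = p * D q + q * D p"
    and nz: "b \<noteq> 0" "d \<noteq> 0" and eq: "a * d = c * b"
  shows "(D a * b - a * D b) * d\<^sup>2 = (D c * d - c * D d) * b\<^sup>2"
proof -
  have "a * D d + d * D a = c * D b + b * D c"
    using arg_cong[OF eq, of D] by (simp add: D)
  then show ?thesis
    using eq by algebra
qed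

text \<open>
  The quotient-rule extension of a derivation \<open>D\<close> to fractions. The description is meaningful only
  if \<open>D\<close> satisfies the product rule, as only then is the value independent of the representation.
\<close>

definition fract_deriv :: "('b::idom \<Rightarrow> 'b) \<Rightarrow> 'b fract \<Rightarrow> 'b fract" where
  "fract_deriv D q =
     (THE r. \<forall>a b. b \<noteq> 0 \<longrightarrow> q = Fract a b \<longrightarrow> r = Fract (D a * b - a * D b) (b\<^sup>2))"

lemma fract_deriv_Fract:
  fixes D :: "'b::idom \<Rightarrow> 'b"
  assumes D: "\<And>p q. D (p * q) = p * D q + q * D p" and "b \<noteq> 0"
  shows "fract_deriv D (Fract a b) = Fract (D a * b - a * D b) (b\<^sup>2)"
  unfolding fract_deriv_def
proof (rule the_equality)
  show "\<forall>c d. d \<noteq> 0 \<longrightarrow> Fract a b = Fract c d \<longrightarrow>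
          Fract (D a * b - a * D b) (b\<^sup>2) = Fract (D c * d - c * D d) (d\<^sup>2)"
    using \<open>b \<noteq> 0\<close> quotient_rule_well_defined[OF D] by (auto simp: eq_fract)
next
  fix r
  assume "\<forall>c d. d \<noteq> 0 \<longrightarrow> Fract a b = Fract c d \<longrightarrow> r = Fract (D c * d - c * D d) (d\<^sup>2)"
  then show "r = Fract (D a * b - a * D b) (b\<^sup>2)"
    using \<open>b \<noteq> 0\<close> by blast
qed

definition partial_x :: "'a::field ratfun \<Rightarrow> 'a ratfun" where
  "partial_x = fract_deriv pderiv_x"

definition partial_y :: "'a::field ratfun \<Rightarrow> 'a ratfun" where
  "partial_y = fract_deriv pderiv_y"

lemma partial_x_Fract:
  "b \<noteq> 0 \<Longrightarrow> partial_x (Fract a b) = Fract (pderiv_x a * b - a * pderiv_x b) (b\<^sup>2)"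
  unfolding partial_x_def by (rule fract_deriv_Fract[OF pderiv_x_mult])

lemma partial_y_Fract:
  "b \<noteq> 0 \<Longrightarrow> partial_y (Fract a b) = Fract (pderiv_y a * b - a * pderiv_y b) (b\<^sup>2)"
  unfolding partial_y_def by (rule fract_deriv_Fract[OF pderiv_mult])

definition poisson_bracket :: "'a::field ratfun \<Rightarrow> 'a ratfun \<Rightarrow> 'a ratfun \<Rightarrow> 'a ratfun" where
  "poisson_bracket f g h = (partial_x g * partial_y h - partial_y g * partial_x h) * f"

subsection \<open>The bracket is the unique Poisson bracket with \<open>{x,y} = f\<close>\<close>

definition derivation_over :: "('a::field ratfun \<Rightarrow> 'a ratfun) \<Rightarrow> bool" where
  "derivation_over D \<longleftrightarrow>
     (\<forall>u v. D (u + v) = D u + D v) \<and> (\<forall>u v. D (u * v) = u * D v + v * D u) \<and>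
     (\<forall>c. D (scalar c) = 0)"

definition is_poisson_bracket :: "('a::field ratfun \<Rightarrow> 'a ratfun \<Rightarrow> 'a ratfun) \<Rightarrow> bool" where
  "is_poisson_bracket B \<longleftrightarrow>
     (\<forall>u. B u u = 0) \<and> (\<forall>u. derivation_over (B u)) \<and> (\<forall>u. derivation_over (\<lambda>v. B v u)) \<and>
     (\<forall>u v w. B u (B v w) + B v (B w u) + B w (B u v) = 0)"

lemma derivation_fract_deriv:
  fixes D :: "'a::field bivar \<Rightarrow> 'a bivar"
  assumes add: "\<And>p q. D (p + q) = D p + D q" and mult: "\<And>p q. D (p * q) = p * D q + q * D p"
    and const: "\<And>c. D [:[:c:]:] = 0"
  shows "derivation_over (fract_deriv D)"
  unfolding derivation_over_def
proof (intro conjI allI)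
  fix u v :: "'a ratfun"
  obtain a b c d where u: "u = Fract a b" "b \<noteq> 0" and v: "v = Fract c d" "d \<noteq> 0"
    by (metis Fract_cases)
  have bd: "b * d \<noteq> 0" using u v by simp
  note F = fract_deriv_Fract[OF mult]
  show "fract_deriv D (u + v) = fract_deriv D u + fract_deriv D v"
    using u v bd by (simp add: F eq_fract add mult power2_eq_square algebra_simps)
  show "fract_deriv D (u * v) = u * fract_deriv D v + v * fract_deriv D u"
    using u v bd by (simp add: F eq_fract add mult power2_eq_square algebra_simps)
next
  fix c
  have "D 1 = 0" using const[of 1] by (simp add: one_pCons)
  then show "fract_deriv D (scalar c) = 0"
    by (simp add: scalar_def to_fract_def fract_deriv_Fract[OF mult] const Zero_fract_def eq_fract)
qed

lemma derivation_partial_x: "derivation_over partial_x"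
  unfolding partial_x_def
  by (rule derivation_fract_deriv)
     (simp_all only: pderiv_x_add pderiv_x_mult, simp add: map_poly_pCons pderiv_pCons)

lemma derivation_partial_y: "derivation_over partial_y"
  unfolding partial_y_def
  by (rule derivation_fract_deriv) (simp_all add: pderiv_add pderiv_mult pderiv_pCons)

lemma derivation_overD:
  assumes "derivation_over D"
  shows "D (u + v) = D u + D v" "D (u * v) = u * D v + v * D u" "D (scalar c) = 0"
        "D 0 = 0" "D 1 = 0" "D (- u) = - D u" "D (u - v) = D u - D v"
proof -
  show A: "D (u + v) = D u + D v" for u v using assms by (simp add: derivation_over_def)
  show "D (u * v) = u * D v + v * D u" "D (scalar c) = 0"
    using assms by (simp_all add: derivation_over_def)
  show Z: "D 0 = 0" using A[of 0 0] by (metis add_0 add_right_cancel)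
  have "scalar 1 = (1 :: 'a ratfun)" by (simp add: scalar_def flip: one_pCons)
  then show "D 1 = 0" using assms by (metis derivation_over_def)
  show N: "D (- u) = - D u" for u using A[of u "- u"] Z by (simp add: eq_neg_iff_add_eq_0 add.commute)
  show "D (u - v) = D u - D v" using A[of u "- v"] N by simp
qed

lemma partial_commute: "partial_x (partial_y u) = partial_y (partial_x u)"
proof -
  obtain a b where u: "u = Fract a b" "b \<noteq> 0" by (metis Fract_cases)
  have c: "pderiv_x (pderiv_y p) = pderiv_y (pderiv_x p)" for p :: "'a bivar"
    by (rule poly_eqI) (simp add: coeff_map_poly coeff_pderiv pderiv_mult pderiv_add pderiv_of_nat)
  have xm: "pderiv_x (p - q) = pderiv_x p - pderiv_x q" for p q :: "'a bivar"
    by (rule poly_eqI) (simp add: coeff_map_poly pderiv_diff)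
  show ?thesis
    using u
    by (simp add: partial_x_Fract partial_y_Fract eq_fract c xm pderiv_diff pderiv_mult
          pderiv_x_mult power2_eq_square algebra_simps)
qed

lemma is_poisson_bracket_poisson_bracket: "is_poisson_bracket (poisson_bracket f)"
  unfolding is_poisson_bracket_def
proof (intro conjI allI)
  note dx = derivation_overD[OF derivation_partial_x]
  note dy = derivation_overD[OF derivation_partial_y]
  fix u v w
  show "poisson_bracket f u u = 0"
    by (simp add: poisson_bracket_def mult.commute)
  show "derivation_over (poisson_bracket f u)" "derivation_over (\<lambda>v. poisson_bracket f v u)"
    by (simp_all add: derivation_over_def poisson_bracket_def dx dy algebra_simps)
  show "poisson_bracket f u (poisson_bracket f v w) + poisson_bracket f v (poisson_bracket f w u) +
        poisson_bracket f w (poisson_bracket f u v) = 0"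
    by (simp add: poisson_bracket_def dx dy partial_commute) algebra
qed

lemma partials_vars:
  "partial_x varX = 1" "partial_y varX = 0" "partial_x varY = 0" "partial_y varY = 1"
  by (simp_all add: varX_def varY_def to_fract_def partial_x_Fract partial_y_Fract
        map_poly_pCons pderiv_pCons Zero_fract_def One_fract_def eq_fract pderiv_x_1 flip: one_pCons)

lemma poisson_bracket_varX_varY: "poisson_bracket f varX varY = f"
  by (simp add: poisson_bracket_def partials_vars)

lemma derivation_over_eqI:
  assumes D: "derivation_over D" and E: "derivation_over E"
    and X: "(D :: 'a::field ratfun \<Rightarrow> 'a ratfun) varX = E varX" and Y: "D varY = E varY"
  shows "D = E"
proof
  note d = derivation_overD[OF D] and e = derivation_overD[OF E]
  have inner: "D (to_fract [:q:]) = E (to_fract [:q:])" for q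
  proof (induction q)
    case 0
    then show ?case by (simp add: d e)
  next
    case (pCons a q)
    have "to_fract [:pCons a q:] = scalar a + varX * to_fract [:q:]"
      by (simp add: scalar_def varX_def flip: to_fract_add to_fract_mult)
    then show ?case using pCons X by (simp add: d e)
  qed
  have poly: "D (to_fract p) = E (to_fract p)" for p
  proof (induction p)
    case 0
    then show ?case by (simp add: d e)
  next
    case (pCons a q)
    have "to_fract (pCons a q) = to_fract [:a:] + varY * to_fract q"
      by (simp add: varY_def flip: to_fract_add to_fract_mult)
    then show ?case using pCons Y inner by (simp add: d e)
  qed
  fix u :: "'a ratfun"
  obtain a b where u: "u = Fract a b" "b \<noteq> 0" by (metis Fract_cases)
  then have ub: "u * to_fract b = to_fract a" and nz: "to_fract b \<noteq> 0"
    by (simp_all add: to_fract_def eq_fract Zero_fract_def)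
  have "D (u * to_fract b) = E (u * to_fract b)"
    using poly ub by simp
  then have "to_fract b * D u = to_fract b * E u"
    by (simp add: d e poly)
  then show "D u = E u" using nz by simp
qed

lemma poisson_bracket_unique:
  fixes f :: "'a::field ratfun"
  assumes B: "is_poisson_bracket B" and xy: "B varX varY = f"
  shows "B = poisson_bracket f"
proof -
  have skew: "B' u v = - B' v u" if "is_poisson_bracket B'"
    for B' :: "'a ratfun \<Rightarrow> 'a ratfun \<Rightarrow> 'a ratfun" and u v
  proof -
    have *: "derivation_over (B' w)" "derivation_over (\<lambda>v. B' v w)" "B' w w = 0" for w
      using that by (auto simp: is_poisson_bracket_def)
    have "B' (u + v) (u + v) = B' u (u + v) + B' v (u + v)"
      using derivation_overD(1)[OF *(2)] by blast
    also have "\<dots> = B' u v + B' v u"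
      by (simp add: derivation_overD(1)[OF *(1)] *(3))
    finally show ?thesis by (simp add: *(3) eq_neg_iff_add_eq_0)
  qed
  define P where "P = poisson_bracket f"
  have P: "is_poisson_bracket P" "P varX varY = f"
    unfolding P_def by (rule is_poisson_bracket_poisson_bracket poisson_bracket_varX_varY)+
  have der: "derivation_over (B u)" "derivation_over (P u)" "B u u = 0" "P u u = 0" for u
    using B P by (auto simp: is_poisson_bracket_def)
  have X: "B varX = P varX"
    by (rule derivation_over_eqI) (simp_all add: der xy P)
  have Y: "B varY = P varY"
    using X by (intro derivation_over_eqI) (simp_all add: der skew[OF B, of varY varX] skew[OF P(1), of varY varX])
  have "B u = P u" for u
    by (rule derivation_over_eqI)
       (simp_all add: der X Y skew[OF B, of u varX] skew[OF P(1), of u varX]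
          skew[OF B, of u varY] skew[OF P(1), of u varY])
  then show ?thesis unfolding P_def by blast
qed

subsection \<open>Isomorphisms\<close>

text \<open>
  Isomorphisms from \<open>K{f}\<close> to \<open>K{g}\<close>. Both have the same underlying field, hence \<open>\<phi>\<close> is an
  automorphism of this field over the scalars. In particular \<open>\<phi> 1 = 1\<close> holds because \<open>1\<close> is a scalar.
\<close>

definition poisson_field_iso ::
  "'a::field ratfun \<Rightarrow> 'a ratfun \<Rightarrow> ('a ratfun \<Rightarrow> 'a ratfun) \<Rightarrow> bool" where
  "poisson_field_iso f g \<phi> \<longleftrightarrow>
     bij \<phi> \<and>
     (\<forall>u v. \<phi> (u + v) = \<phi> u + \<phi> v) \<and>
     (\<forall>u v. \<phi> (u * v) = \<phi> u * \<phi> v) \<and>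
     (\<forall>c. \<phi> (scalar c) = scalar c) \<and>
     (\<forall>u v. \<phi> (poisson_bracket f u v) = poisson_bracket g (\<phi> u) (\<phi> v))"

definition poisson_field_isomorphic :: "'a::field ratfun \<Rightarrow> 'a ratfun \<Rightarrow> bool" where
  "poisson_field_isomorphic f g \<longleftrightarrow> (\<exists>\<phi>. poisson_field_iso f g \<phi>)"

definition splits :: "'a::field poly \<Rightarrow> bool" where
  "splits p \<longleftrightarrow> (\<exists>as. p = smult (lead_coeff p) (\<Prod>a\<leftarrow>as. [:- a, 1:]))"

end

theory Submission
  imports Defs "Berlekamp_Zassenhaus.Unique_Factorization_Poly"
begin

text \<open>Leaves \<open>$\<close> to the entries of matrices of type \<open>'a^2^2\<close>, as the
  theorem uses it.\<close>

no_notation Matrix.vec_index (infixl \<open>$\<close> 100)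

text \<open>
  An isomorphism \<open>\<phi>\<close> satisfies \<open>f(X, Y) = J g\<close>, where \<open>X\<close> and \<open>Y\<close> are the images of the variables
  and \<open>J\<close> is their Jacobian determinant. Suppose that \<open>X\<close> has a pole along a prime \<open>p\<close> of the
  polynomial ring. The logarithmic form \<open>dlog (X - a) \<and> dlog (Y - b)\<close> has at most a simple pole along
  \<open>p\<close>, and for a suitable root \<open>b\<close> the other factors of \<open>g\<^sub>1(Y)\<close> do not vanish along \<open>p\<close>, as the
  roots are distinct; since \<open>deg f\<^sub>1 \<ge> 3\<close>, the equation then cannot hold. So \<open>X\<close>, and likewise
  \<open>Y\<close>, is a polynomial. The same applies to the inverse of \<open>\<phi>\<close>, hence \<open>\<phi>\<close> restricts to an
  automorphism of the polynomial ring. By unique factorization it matches the linear factors of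
  \<open>f\<close> with those of \<open>g\<close> up to scalars, which makes \<open>X\<close> and \<open>Y\<close> affine functions of single variables.
\<close>

subsection \<open>Localization at a prime\<close>

text \<open>For prime \<open>p\<close> this is the local ring at the ideal generated by
  \<open>p\<close>, kept as a subset of the fraction field so that having no pole along
  \<open>p\<close> becomes a membership.\<close>

definition localization :: "'b::idom \<Rightarrow> 'b fract set" where
  "localization p = {to_fract a / to_fract b | a b. \<not> p dvd b}"

lemma localizationI:
  assumes "\<not> p dvd b" "u * to_fract b = to_fract a"
  shows "u \<in> localization p"
proof -
  have "b \<noteq> 0" using assms by auto
  then have "u = to_fract a / to_fract b" using assms by (simp add: nonzero_eq_divide_eq)
  then show ?thesis unfolding localization_def using assms(1) by blast
qed

lemma localizationE:
  assumes "u \<in> localization p"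
  obtains a b where "\<not> p dvd b" "b \<noteq> 0" "u = to_fract a / to_fract b"
proof -
  obtain a b where "\<not> p dvd b" "u = to_fract a / to_fract b"
    using assms unfolding localization_def by auto
  moreover from this have "b \<noteq> 0" by auto
  ultimately show ?thesis using that by blast
qed

lemma to_fract_in_localization: "prime_elem p \<Longrightarrow> to_fract a \<in> localization p"
  by (rule localizationI[of p 1 _ a]) (auto simp: prime_elem_not_unit)

lemma localization_mult:
  assumes "prime_elem p" "u \<in> localization p" "v \<in> localization p"
  shows "u * v \<in> localization p"
proof -
  from assms(2) obtain a b where u: "\<not> p dvd b" "b \<noteq> 0" "u = to_fract a / to_fract b"
    by (rule localizationE)
  from assms(3) obtain c d where v: "\<not> p dvd d" "d \<noteq> 0" "v = to_fract c / to_fract d"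
    by (rule localizationE)
  have "\<not> p dvd b * d" using u v assms(1) by (simp add: prime_elem_dvd_mult_iff)
  then show ?thesis
    by (rule localizationI[of _ _ _ "a * c"]) (use u v in \<open>simp add: field_simps\<close>)
qed

lemma localization_diff:
  assumes "prime_elem p" "u \<in> localization p" "v \<in> localization p"
  shows "u - v \<in> localization p"
proof -
  from assms(2) obtain a b where u: "\<not> p dvd b" "b \<noteq> 0" "u = to_fract a / to_fract b"
    by (rule localizationE)
  from assms(3) obtain c d where v: "\<not> p dvd d" "d \<noteq> 0" "v = to_fract c / to_fract d"
    by (rule localizationE)
  have "\<not> p dvd b * d" using u v assms(1) by (simp add: prime_elem_dvd_mult_iff)
  then show ?thesis
    by (rule localizationI[of _ _ _ "a * d - c * b"]) (use u v in \<open>simp add: field_simps\<close>)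
qed

lemma localization_uminus: "prime_elem p \<Longrightarrow> u \<in> localization p \<Longrightarrow> - u \<in> localization p"
  using localization_diff[of p 0 u] to_fract_in_localization[of p 0] by simp

lemma localization_add:
  "prime_elem p \<Longrightarrow> u \<in> localization p \<Longrightarrow> v \<in> localization p \<Longrightarrow> u + v \<in> localization p"
  using localization_diff[of p u "- v"] localization_uminus[of p v] by simp

lemma localization_prod_list:
  "prime_elem p \<Longrightarrow> (\<And>x. x \<in> set xs \<Longrightarrow> h x \<in> localization p) \<Longrightarrow>
    (\<Prod>x\<leftarrow>xs. h x) \<in> localization p"
  using to_fract_in_localization[of p 1] by (induction xs) (simp_all add: localization_mult)

text \<open>A representation \<open>a / b\<close> would force \<open>b = p * a\<close>. The
  contradictions about poles below all end here.\<close>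

lemma prime_inverse_notin_localization:
  assumes "prime_elem p"
  shows "1 / to_fract p \<notin> localization p"
proof
  assume "1 / to_fract p \<in> localization p"
  then obtain a b where ab: "\<not> p dvd b" "b \<noteq> 0" "1 / to_fract p = to_fract a / to_fract b"
    by (rule localizationE)
  then have "to_fract b = to_fract (p * a)"
    using assms by (auto simp: field_simps prime_elem_def)
  then have "b = p * a" by (simp del: to_fract_mult to_fract_hom.hom_mult)
  then show False using ab by simp
qed

text \<open>The factor \<open>u\<close> accommodates the units, which get the empty multiset; for
  nonunits it is 1.\<close>

lemma prime_factorization_exists:
  fixes a :: "'b::ufd"
  assumes "a \<noteq> 0"
  obtains u M where "u dvd 1" "\<forall>q\<in>#M. prime_elem q" "a = u * prod_mset M"
proof (cases "a dvd 1")
  case True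
  then show ?thesis using that[of a "{#}"] by simp
next
  case False
  then obtain F where "mset_factors F a" using mset_factors_exist assms by blast
  then show ?thesis using that[of 1 F] unfolding mset_factors_def by auto
qed

text \<open>Induction on a prime factorization: a prime that \<open>p\<close> divides is a unit
  multiple of \<open>p\<close> and raises the exponent, any other prime goes into
  \<open>c\<close>.\<close>

lemma prime_power_decomposition:
  fixes a p :: "'b::ufd"
  assumes p: "prime_elem p" and "a \<noteq> 0"
  obtains m c where "a = p ^ m * c" "\<not> p dvd c"
proof -
  obtain u M where u: "u dvd 1" and M: "\<forall>q\<in>#M. prime_elem q" and a: "a = u * prod_mset M"
    using prime_factorization_exists[OF \<open>a \<noteq> 0\<close>] .
  have "\<exists>m c. u * prod_mset M = p ^ m * c \<and> \<not> p dvd c"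
    using M
  proof (induction M)
    case empty
    have "\<not> p dvd u" using u p by (metis dvd_trans prime_elem_not_unit)
    then show ?case by (intro exI[of _ 0] exI[of _ u]) simp
  next
    case (add q M)
    then obtain m c where mc: "u * prod_mset M = p ^ m * c" "\<not> p dvd c" by auto
    have eq: "u * prod_mset (add_mset q M) = p ^ m * (q * c)"
      using mc by (simp add: algebra_simps)
    show ?case
    proof (cases "p dvd q")
      case False
      then have "\<not> p dvd q * c" using mc p by (simp add: prime_elem_dvd_mult_iff)
      then show ?thesis using eq by blast
    next
      case True
      then obtain s where s: "q = p * s" by blast
      have "irreducible q" using add.prems by (auto intro: prime_elem_imp_irreducible)
      then have "s dvd 1" using s p by (auto dest: irreducibleD simp: prime_elem_not_unit)
      then have "\<not> p dvd s * c"
        using mc p by (metis dvd_trans prime_elem_dvd_mult_iff prime_elem_not_unit)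
      moreover have "u * prod_mset (add_mset q M) = p ^ Suc m * (s * c)"
        using eq s by (simp add: algebra_simps)
      ultimately show ?thesis by blast
    qed
  qed
  then obtain m c where "u * prod_mset M = p ^ m * c" "\<not> p dvd c" by auto
  then show ?thesis using that[of m c] a by simp
qed

text \<open>The localization of a factorial ring at a prime is a discrete valuation ring.\<close>

lemma inverse_in_localization:
  fixes u :: "'b::ufd fract"
  assumes p: "prime_elem p" and u: "u \<notin> localization p"
  shows "1 / u / to_fract p \<in> localization p"
proof -
  have "u \<noteq> 0" using to_fract_in_localization[OF p, of 0] u by auto
  obtain a b where ab: "u = Fract a b" "b \<noteq> 0" by (rule Fract_cases)
  have "a \<noteq> 0" using ab \<open>u \<noteq> 0\<close> by (auto simp: Zero_fract_def eq_fract)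
  have u_eq: "u = to_fract a / to_fract b" using ab by (simp add: to_fract_def)
  obtain m c where a: "a = p ^ m * c" "\<not> p dvd c" using prime_power_decomposition[OF p \<open>a \<noteq> 0\<close>] .
  obtain n d where b: "b = p ^ n * d" "\<not> p dvd d" using prime_power_decomposition[OF p \<open>b \<noteq> 0\<close>] .
  have p0: "to_fract p \<noteq> 0" using p by (auto simp: prime_elem_def)
  have cd: "to_fract c \<noteq> 0" "to_fract d \<noteq> 0" using a b by auto
  show ?thesis
  proof (cases "n \<le> m")
    case True
    \<comment> \<open>Here \<open>u\<close> would have no pole, contrary to the hypothesis.\<close>
    then obtain k where k: "m = n + k" by (metis le_Suc_ex)
    have "u \<in> localization p"
      by (rule localizationI[of p d u "p ^ k * c"])
         (use a b cd p0 in \<open>simp_all add: u_eq k power_add field_simps\<close>)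
    then show ?thesis using u by simp
  next
    case False
    \<comment> \<open>The pole has order \<open>k + 1\<close>, so \<open>1 / u\<close> still lies in
      the localization after one division by \<open>p\<close>.\<close>
    then obtain k where k: "n = Suc (m + k)" by (metis less_iff_Suc_add not_le)
    show ?thesis
      by (rule localizationI[of p c _ "p ^ k * d"])
         (use a b cd p0 in \<open>simp_all add: u_eq k power_add field_simps\<close>)
  qed
qed

text \<open>The primes of a denominator are cancelled one at a time: membership in the localization
  at \<open>q\<close> shows that \<open>q\<close> divides the current numerator.\<close>

lemma in_all_localizations_imp_integral:
  fixes u :: "'b::ufd fract"
  assumes u: "\<And>p. prime_elem p \<Longrightarrow> u \<in> localization p"
  shows "u \<in> range to_fract"
proof -
  obtain a b where ab: "u = Fract a b" "b \<noteq> 0" by (rule Fract_cases)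
  obtain e M where e: "e dvd 1" and M: "\<forall>q\<in>#M. prime_elem q" and b: "b = e * prod_mset M"
    using prime_factorization_exists[OF \<open>b \<noteq> 0\<close>] .
  obtain e' where e': "1 = e * e'" using e by (rule dvdE)
  have "u * to_fract b = to_fract a" using ab by (simp add: to_fract_def Zero_fract_def eq_fract)
  then have "u * to_fract (prod_mset M) * to_fract (e * e') = to_fract (a * e')"
    unfolding b by (simp add: algebra_simps)
  then have "u * to_fract (prod_mset M) = to_fract (a * e')" unfolding e'[symmetric] by simp
  then have "\<exists>c. u * to_fract (prod_mset M) = to_fract c" by blast
  then have "\<exists>c. u = to_fract c"
    using M
  proof (induction M)
    case empty
    then show ?case by simp
  next
    case (add q M)
    then have q: "prime_elem q" by simp
    then have q0: "to_fract q \<noteq> 0" by (auto simp: prime_elem_def)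
    obtain c where c: "u * to_fract (prod_mset (add_mset q M)) = to_fract c"
      using add.prems by blast
    obtain f d where d: "\<not> q dvd d" "d \<noteq> 0" "u = to_fract f / to_fract d"
      using u[OF q] by (rule localizationE)
    have "to_fract (c * d) = to_fract (f * (q * prod_mset M))"
      using c d(2) unfolding d(3) by (simp add: field_simps)
    then have "c * d = f * (q * prod_mset M)"
      by (simp only: to_fract_hom.eq_iff)
    then have "q dvd c * d" by simp
    then obtain s where "c = q * s" using q d(1) by (auto simp: prime_elem_dvd_mult_iff)
    then have "u * to_fract (prod_mset M) = to_fract s" using c q0 by simp
    then show ?case using add by auto
  qed
  then show ?thesis by blast
qed

subsection \<open>Logarithmic derivatives\<close>

text \<open>Collects what the pole estimates use of \<open>partial_x\<close> and
  \<open>partial_y\<close>, so that both are treated at once.\<close>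

definition integral_derivation :: "('a::field ratfun \<Rightarrow> 'a ratfun) \<Rightarrow> bool" where
  "integral_derivation D \<longleftrightarrow> derivation_over D \<and> (\<forall>a. D (to_fract a) \<in> range to_fract)"

lemma partial_x_to_fract: "partial_x (to_fract a) = to_fract (pderiv_x a)"
  by (simp add: to_fract_def partial_x_Fract pderiv_x_1)

lemma partial_y_to_fract: "partial_y (to_fract a) = to_fract (pderiv_y a)"
  by (simp add: to_fract_def partial_y_Fract)

lemma integral_derivation_partials: "integral_derivation partial_x" "integral_derivation partial_y"
  by (simp_all add: integral_derivation_def derivation_partial_x derivation_partial_y
      partial_x_to_fract partial_y_to_fract)

lemma integral_derivation_to_fract_in_localization:
  assumes "integral_derivation D" "prime_elem p"
  shows "D (to_fract a) \<in> localization p"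
proof -
  obtain b where "D (to_fract a) = to_fract b"
    using assms(1) unfolding integral_derivation_def by auto
  then show ?thesis using to_fract_in_localization[OF assms(2)] by simp
qed

text \<open>Differentiating \<open>u * b = a\<close> and solving for \<open>D u\<close> costs only a
  division by \<open>b\<close>, which is a unit of the localization.\<close>

lemma integral_derivation_localization:
  assumes D: "integral_derivation D" and p: "prime_elem p" and u: "u \<in> localization p"
  shows "D u \<in> localization p"
proof -
  note d = derivation_overD[OF D[unfolded integral_derivation_def, THEN conjunct1]]
  note i = integral_derivation_to_fract_in_localization[OF D p]
  from u obtain a b where ab: "\<not> p dvd b" "b \<noteq> 0" "u = to_fract a / to_fract b"
    by (rule localizationE)
  have inv: "1 / to_fract b \<in> localization p"
    by (rule localizationI[OF ab(1), of _ 1]) (use ab in simp)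
  have "u * to_fract b = to_fract a" using ab by simp
  then have "u * D (to_fract b) + to_fract b * D u = D (to_fract a)"
    by (metis d(2))
  then have "D u = (D (to_fract a) - u * D (to_fract b)) * (1 / to_fract b)"
    using ab(2) by (simp add: nonzero_eq_divide_eq algebra_simps)
  then show ?thesis
    using localization_mult[OF p localization_diff[OF p i localization_mult[OF p u i]] inv] by simp
qed

lemma log_derivation_mult:
  assumes "derivation_over D" "u \<noteq> 0" "v \<noteq> 0"
  shows "D (u * v) / (u * v) = D u / u + D v / v"
  using assms by (simp add: derivation_overD(2) add_divide_distrib)

lemma log_derivation_power:
  assumes "derivation_over D" "u \<noteq> 0"
  shows "D (u ^ n) / u ^ n = of_nat n * (D u / u)"
  using assms
  by (induction n) (simp_all add: derivation_overD(5) log_derivation_mult algebra_simps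
      add_divide_distrib)

text \<open>Up to a unit of the localization, \<open>u\<close> is a power of \<open>p\<close>, and
  \<open>c\<close> is its exponent. It is the same for all \<open>D\<close>; this makes the double
  poles cancel in the Jacobian.\<close>

lemma log_derivation_mod_localization:
  fixes u :: "'a::field ratfun"
  assumes p: "prime_elem p" and "u \<noteq> 0"
  obtains c where
    "\<And>D. integral_derivation D \<Longrightarrow>
       D u / u - to_fract c * (D (to_fract p) / to_fract p) \<in> localization p"
proof -
  obtain a b where ab: "u = Fract a b" "b \<noteq> 0" by (rule Fract_cases)
  have "a \<noteq> 0" using ab \<open>u \<noteq> 0\<close> by (auto simp: Zero_fract_def eq_fract)
  have u_eq: "u * to_fract b = to_fract a"
    using ab by (simp add: to_fract_def Zero_fract_def eq_fract)
  obtain m a' where a: "a = p ^ m * a'" "\<not> p dvd a'"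
    using prime_power_decomposition[OF p \<open>a \<noteq> 0\<close>] .
  obtain n b' where b: "b = p ^ n * b'" "\<not> p dvd b'"
    using prime_power_decomposition[OF p \<open>b \<noteq> 0\<close>] .
  have p0: "to_fract p \<noteq> 0" using p by (auto simp: prime_elem_def)
  have nz: "to_fract a' \<noteq> 0" "to_fract b' \<noteq> 0" using a b by auto
  define v where "v = to_fract a' / to_fract b'"
  have v0: "v \<noteq> 0" using nz by (simp add: v_def)
  have v: "v \<in> localization p"
    by (rule localizationI[OF b(2), of _ a']) (use nz in \<open>simp add: v_def\<close>)
  have v': "1 / v \<in> localization p"
    by (rule localizationI[OF a(2), of _ b']) (use nz in \<open>simp add: v_def\<close>)
  \<comment> \<open>Keeping a power on each side avoids a negative exponent when
    \<open>m < n\<close>.\<close>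
  have eq: "u * to_fract p ^ n = v * to_fract p ^ m"
  proof -
    have "to_fract b' * (u * to_fract p ^ n) = to_fract a' * to_fract p ^ m"
      using u_eq unfolding a b by (simp add: mult_ac to_fract_hom.hom_power)
    also have "\<dots> = to_fract b' * (v * to_fract p ^ m)"
      using nz by (simp add: v_def)
    finally show ?thesis using nz by simp
  qed
  have of_nat_to_fract: "to_fract (of_nat k) = (of_nat k :: 'a ratfun)" for k
    by (induction k) simp_all
  have "D u / u - to_fract (of_nat m - of_nat n) * (D (to_fract p) / to_fract p) \<in> localization p"
    if D: "integral_derivation D" for D
  proof -
    have d: "derivation_over D" using D by (simp add: integral_derivation_def)
    have "D u / u + of_nat n * (D (to_fract p) / to_fract p) =
          D (u * to_fract p ^ n) / (u * to_fract p ^ n)"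
      using log_derivation_mult[OF d \<open>u \<noteq> 0\<close>, of "to_fract p ^ n"] p0
      by (simp only: log_derivation_power[OF d p0] power_not_zero simp_thms)
    also have "\<dots> = D v / v + of_nat m * (D (to_fract p) / to_fract p)"
      unfolding eq using log_derivation_mult[OF d v0, of "to_fract p ^ m"] p0
      by (simp only: log_derivation_power[OF d p0] power_not_zero simp_thms)
    finally have "D u / u - to_fract (of_nat m - of_nat n) * (D (to_fract p) / to_fract p) = D v * (1 / v)"
      by (simp add: algebra_simps of_nat_to_fract diff_divide_distrib)
    then show ?thesis
      using localization_mult[OF p integral_derivation_localization[OF D p v] v'] by simp
  qed
  then show ?thesis by (rule that)
qed

text \<open>The wedge product of two logarithmic forms has at most a simple pole.\<close>

lemma log_jacobian_in_localization:
  fixes u w :: "'a::field ratfun"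
  assumes p: "prime_elem p" and "u \<noteq> 0" "w \<noteq> 0"
  shows "to_fract p * poisson_bracket 1 u w / (u * w) \<in> localization p"
proof -
  let ?O = "localization p"
  let ?P = "partial_x (to_fract p)" and ?Q = "partial_y (to_fract p)"
  note int = integral_derivation_partials
  have p0: "to_fract p \<noteq> 0" using p by (auto simp: prime_elem_def)
  obtain c where c: "\<And>D. integral_derivation D \<Longrightarrow>
       D u / u - to_fract c * (D (to_fract p) / to_fract p) \<in> ?O"
    using log_derivation_mod_localization[OF p \<open>u \<noteq> 0\<close>] by blast
  obtain d where d: "\<And>D. integral_derivation D \<Longrightarrow>
       D w / w - to_fract d * (D (to_fract p) / to_fract p) \<in> ?O"
    using log_derivation_mod_localization[OF p \<open>w \<noteq> 0\<close>] by blast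
  define A where "A = partial_x u / u - to_fract c * (?P / to_fract p)"
  define B where "B = partial_y u / u - to_fract c * (?Q / to_fract p)"
  define C where "C = partial_x w / w - to_fract d * (?P / to_fract p)"
  define E where "E = partial_y w / w - to_fract d * (?Q / to_fract p)"
  have mem: "A \<in> ?O" "B \<in> ?O" "C \<in> ?O" "E \<in> ?O"
    unfolding A_def B_def C_def E_def by (rule c[OF int(1)] c[OF int(2)] d[OF int(1)] d[OF int(2)])+
  \<comment> \<open>The products of two principal parts, \<open>e * P * f * Q\<close> and
    \<open>e * Q * f * P\<close>, cancel. Each remaining term contains at most one of
    \<open>P\<close> and \<open>Q\<close>, and the factor \<open>q\<close> clears its pole.\<close>
  have expand: "q * ((A + e * P) * (E + f * Q) - (B + e * Q) * (C + f * P)) =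
      e * (q * P * E - q * Q * C) + f * (A * (q * Q) - B * (q * P)) + q * (A * E - B * C)"
    for q e f P Q :: "'a ratfun"
    by (simp add: algebra_simps)
  have "to_fract p * poisson_bracket 1 u w / (u * w) = to_fract p *
        (partial_x u / u * (partial_y w / w) - partial_y u / u * (partial_x w / w))"
    by (simp add: poisson_bracket_def diff_divide_distrib right_diff_distrib mult_ac)
  also have "\<dots> = to_fract p *
      ((A + to_fract c * (?P / to_fract p)) * (E + to_fract d * (?Q / to_fract p))
       - (B + to_fract c * (?Q / to_fract p)) * (C + to_fract d * (?P / to_fract p)))"
    by (simp add: A_def B_def C_def E_def)
  also have "\<dots> =
      to_fract c * (?P * E - ?Q * C) + to_fract d * (A * ?Q - B * ?P) + to_fract p * (A * E - B * C)"
    unfolding expand using p0 by simp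
  also have "\<dots> \<in> ?O"
    by (intro localization_add[OF p] localization_diff[OF p] localization_mult[OF p]
        to_fract_in_localization[OF p] integral_derivation_to_fract_in_localization[OF int(1) p]
        integral_derivation_to_fract_in_localization[OF int(2) p] mem)
  finally show ?thesis .
qed

subsection \<open>Regularity of the components\<close>

lemma prod_list_inverse:
  fixes h :: "'b \<Rightarrow> 'c::field"
  shows "(\<And>x. x \<in> set xs \<Longrightarrow> h x \<noteq> 0) \<Longrightarrow> (\<Prod>x\<leftarrow>xs. 1 / h x) * (\<Prod>x\<leftarrow>xs. h x) = 1"
  by (induction xs) (simp_all add: divide_simps)

lemma scalar_diff: "scalar (a - b) = scalar a - scalar b"
  by (simp add: scalar_def flip: to_fract_diff)

lemma scalar_mult: "scalar (a * b) = scalar a * scalar b"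
  by (simp add: scalar_def flip: to_fract_mult)

lemma scalar_1: "scalar 1 = 1"
  by (simp add: scalar_def flip: one_pCons)

lemma scalar_eq_0_iff: "scalar a = 0 \<longleftrightarrow> a = 0"
  by (simp add: scalar_def)

lemma scalar_in_localization: "prime_elem p \<Longrightarrow> scalar a \<in> localization p"
  unfolding scalar_def by (rule to_fract_in_localization)

lemma scalar_over_prime_notin_localization:
  fixes a :: "'a::field"
  assumes p: "prime_elem p" and "a \<noteq> 0"
  shows "scalar a / to_fract p \<notin> localization p"
proof
  assume "scalar a / to_fract p \<in> localization p"
  then have "scalar (1 / a) * (scalar a / to_fract p) \<in> localization p"
    by (rule localization_mult[OF p scalar_in_localization[OF p]])
  moreover have "scalar (1 / a) * scalar a = 1"
    using \<open>a \<noteq> 0\<close> by (simp flip: scalar_mult add: scalar_1)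
  ultimately show False
    using prime_inverse_notin_localization[OF p] by simp
qed

text \<open>Arithmetic of the pole argument: \<open>q\<close> is the prime, \<open>x1\<close>,
  \<open>x2\<close>, \<open>x3\<close> are three factors in \<open>X\<close>, \<open>y\<close> is
  one factor in \<open>Y\<close>, \<open>PX\<close> and \<open>PY\<close> are the remaining products
  with inverses \<open>IX\<close> and \<open>IY\<close>. Dividing twice by \<open>q\<close> against
  the single \<open>q\<close> of the logarithmic form leaves \<open>S / q\<close>.\<close>

lemma cancel_factors:
  fixes x1 :: "'b::field"
  assumes "J * g = S * (x1 * (x2 * (x3 * PX))) * (y * PY)" "x1 \<noteq> 0" "x2 \<noteq> 0" "x3 \<noteq> 0" "y \<noteq> 0" "q \<noteq> 0"
    "IX * PX = 1" "IY * PY = 1"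
  shows "q * J / (x1 * y) * g * (1 / x2 / q) * (1 / x3 / q) * IX * IY = S / q"
proof -
  have nz: "PX \<noteq> 0" "PY \<noteq> 0" using assms(7,8) by auto
  then have I: "IX = 1 / PX" "IY = 1 / PY" using assms(7,8) by (simp_all add: nonzero_eq_divide_eq)
  have "q * J / (x1 * y) * g * (1 / x2 / q) * (1 / x3 / q) * IX * IY =
     q * (J * g) / (x1 * y * x2 * q * x3 * q * PX * PY)"
    unfolding I by (simp add: mult_ac)
  also have "\<dots> = S / q"
    unfolding assms(1) using assms(2-6) nz by (simp add: divide_simps)
  finally show ?thesis .
qed

text \<open>
  At a pole of \<open>X\<close> the factors of \<open>X\<close> on the right contribute a pole of order at least three,
  while the logarithmic form on the left accounts for at most one factor in each of \<open>X\<close> and \<open>Y\<close>.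
\<close>

lemma jacobian_equation_imp_integral:
  fixes X Y :: "'a::field ratfun" and as bs :: "'a list"
  assumes eq: "poisson_bracket (to_fract G) X Y =
      scalar \<gamma> * (\<Prod>a\<leftarrow>as. X - scalar a) * (\<Prod>b\<leftarrow>bs. Y - scalar b)"
    and "\<gamma> \<noteq> 0" and len: "length as \<ge> 3" and "bs \<noteq> []" and dist: "distinct bs"
    and Y: "\<And>b. Y \<noteq> scalar b"
  shows "X \<in> range to_fract"
proof (rule in_all_localizations_imp_integral, rule ccontr)
  fix p :: "'a bivar"
  assume p: "prime_elem p" and X: "X \<notin> localization p"
  let ?O = "localization p" and ?\<pi> = "to_fract p"
  note mult = localization_mult[OF p]
  have p0: "?\<pi> \<noteq> 0" using p by (auto simp: prime_elem_def)
  have Xa: "X - scalar a \<notin> ?O" for a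
    using localization_add[OF p, of "X - scalar a" "scalar a"] scalar_in_localization[OF p] X by auto
  then have Xa0: "X - scalar a \<noteq> 0" for a
    using to_fract_in_localization[OF p, of 0] by (metis to_fract_0)
  have Xinv: "1 / (X - scalar a) / ?\<pi> \<in> ?O" for a
    by (rule inverse_in_localization[OF p Xa])
  have Xinv': "1 / (X - scalar a) \<in> ?O" for a
    using mult[OF to_fract_in_localization[OF p, of p] Xinv[of a]] p0 by simp
  have Y0: "Y - scalar b \<noteq> 0" for b using Y by simp
  \<comment> \<open>If \<open>1 / (Y - scalar b)\<close> has a pole, then
    \<open>Y - scalar b\<close> vanishes along \<open>p\<close>. For two values of \<open>b\<close>
    the difference would be a nonzero constant vanishing along \<open>p\<close>.\<close>
  have Ysmall: "b = b'" if "1 / (Y - scalar b) \<notin> ?O" "1 / (Y - scalar b') \<notin> ?O" for b b'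
  proof (rule ccontr)
    assume "b \<noteq> b'"
    have "(Y - scalar b') / ?\<pi> - (Y - scalar b) / ?\<pi> \<in> ?O"
      using inverse_in_localization[OF p that(1)] inverse_in_localization[OF p that(2)]
      by (intro localization_diff[OF p]) simp_all
    then have "scalar (b - b') / ?\<pi> \<in> ?O"
      by (simp add: scalar_diff diff_divide_distrib)
    then show False
      using scalar_over_prime_notin_localization[OF p, of "b - b'"] \<open>b \<noteq> b'\<close> by simp
  qed
  \<comment> \<open>The one root at which \<open>Y - scalar b\<close> vanishes along
    \<open>p\<close>, if it exists, and otherwise any root.\<close>
  obtain b where b: "b \<in> set bs" "\<And>b'. b' \<in> set bs \<Longrightarrow> b' \<noteq> b \<Longrightarrow> 1 / (Y - scalar b') \<in> ?O"
    using Ysmall \<open>bs \<noteq> []\<close> by (metis list.set_sel(1))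
  obtain xs ys where bs: "bs = xs @ b # ys" using b(1) by (metis split_list)
  let ?zs = "xs @ ys"
  \<comment> \<open>Distinctness of \<open>bs\<close> keeps \<open>b\<close> from recurring in
    \<open>?zs\<close>.\<close>
  have Yinv: "(\<Prod>b\<leftarrow>?zs. 1 / (Y - scalar b)) \<in> ?O"
    using b(2) dist unfolding bs by (intro localization_prod_list[OF p]) auto
  \<comment> \<open>The factor at \<open>a\<close> enters the logarithmic form; those at
    \<open>a2\<close> and \<open>a3\<close> each absorb a division by the prime.\<close>
  obtain a a2 a3 cs where as: "as = a # a2 # a3 # cs"
    using len by (metis Suc_le_length_iff numeral_3_eq_3)
  let ?L = "?\<pi> * poisson_bracket 1 (X - scalar a) (Y - scalar b) / ((X - scalar a) * (Y - scalar b))"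
  have L: "?L \<in> ?O" by (rule log_jacobian_in_localization[OF p Xa0 Y0])
  have "poisson_bracket (to_fract G) X Y = poisson_bracket 1 (X - scalar a) (Y - scalar b) * to_fract G"
    by (simp add: poisson_bracket_def derivation_overD[OF derivation_partial_x]
        derivation_overD[OF derivation_partial_y])
  then have main: "poisson_bracket 1 (X - scalar a) (Y - scalar b) * to_fract G =
      scalar \<gamma> * ((X - scalar a) * ((X - scalar a2) * ((X - scalar a3) * (\<Prod>a\<leftarrow>cs. X - scalar a)))) *
      ((Y - scalar b) * (\<Prod>b\<leftarrow>?zs. Y - scalar b))"
    using eq unfolding as bs by (simp add: mult_ac)
  have inv: "(\<Prod>a\<leftarrow>cs. 1 / (X - scalar a)) * (\<Prod>a\<leftarrow>cs. X - scalar a) = 1"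
    "(\<Prod>b\<leftarrow>?zs. 1 / (Y - scalar b)) * (\<Prod>b\<leftarrow>?zs. Y - scalar b) = 1"
    using Xa0 Y0 by (intro prod_list_inverse; simp)+
  \<comment> \<open>A product of elements of the localization turns out to be a nonzero constant
    divided by the prime.\<close>
  have "?L * to_fract G * (1 / (X - scalar a2) / ?\<pi>) * (1 / (X - scalar a3) / ?\<pi>) *
      (\<Prod>a\<leftarrow>cs. 1 / (X - scalar a)) * (\<Prod>b\<leftarrow>?zs. 1 / (Y - scalar b)) = scalar \<gamma> / ?\<pi>"
    by (rule cancel_factors[OF main Xa0 Xa0 Xa0 Y0 p0 inv])
  moreover have "?L * to_fract G * (1 / (X - scalar a2) / ?\<pi>) * (1 / (X - scalar a3) / ?\<pi>) *
      (\<Prod>a\<leftarrow>cs. 1 / (X - scalar a)) * (\<Prod>b\<leftarrow>?zs. 1 / (Y - scalar b)) \<in> ?O"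
    by (intro mult L to_fract_in_localization[OF p] Xinv Yinv localization_prod_list[OF p] Xinv')
  ultimately show False
    using scalar_over_prime_notin_localization[OF p \<open>\<gamma> \<noteq> 0\<close>] by simp
qed

subsection \<open>Linear factors\<close>

text \<open>Divisibility by \<open>[:- c, 1:]\<close> means vanishing at \<open>c\<close>. The
  coefficients may form any domain because the factors in \<open>y\<close> have coefficients in the
  polynomials in \<open>x\<close>.\<close>

lemma prime_elem_linear: "prime_elem [:- c, 1 :: 'b::idom:]"
  unfolding prime_elem_def
proof (intro conjI allI impI)
  show "[:- c, 1:] \<noteq> 0" by simp
  show "\<not> [:- c, 1:] dvd 1" unfolding poly_eq_0_iff_dvd[symmetric] by simp
  fix p q
  assume "[:- c, 1:] dvd p * q"
  then show "[:- c, 1:] dvd p \<or> [:- c, 1:] dvd q" unfolding poly_eq_0_iff_dvd[symmetric] by simp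
qed

lemma scalar_uminus: "scalar (- a) = - scalar a"
  by (simp add: scalar_def flip: to_fract_uminus)

lemma scalar_0: "scalar 0 = 0"
  by (simp add: scalar_eq_0_iff)

lemma varX_minus_scalar: "varX - scalar a = to_fract [:[:- a, 1:]:]"
  by (simp add: varX_def scalar_def flip: to_fract_diff)

lemma varY_minus_scalar: "varY - scalar b = to_fract [:- [:b:], 1:]"
  by (simp add: varY_def scalar_def flip: to_fract_diff)

lemma in_x_mult: "in_x (p * q) = in_x p * in_x q"
  by (simp add: in_x_def)

lemma to_fract_prod_list: "to_fract (prod_list us) = prod_list (map to_fract us)"
  by (induction us) simp_all

lemma to_fract_in_x:
  "to_fract (in_x (\<Prod>a\<leftarrow>as. [:- a, 1:])) = (\<Prod>a\<leftarrow>as. varX - scalar a)"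
proof (induction as)
  case Nil
  then show ?case by (simp add: in_x_def flip: one_pCons)
next
  case (Cons a as)
  have "to_fract (in_x [:- a, 1:]) = varX - scalar a" unfolding in_x_def varX_minus_scalar ..
  then show ?case using Cons by (simp only: list.map prod_list.Cons in_x_mult to_fract_mult)
qed

lemma in_y_mult: "in_y (p * q) = in_y p * in_y q"
proof (rule poly_eqI)
  fix n
  have sum: "(\<Sum>i\<in>A. [:h i:]) = [:\<Sum>i\<in>A. h i:]" for A and h :: "nat \<Rightarrow> 'a"
    by (induction A rule: infinite_finite_induct) simp_all
  show "coeff (in_y (p * q)) n = coeff (in_y p * in_y q) n"
    by (simp add: in_y_def coeff_map_poly coeff_mult sum mult.commute)
qed

lemma to_fract_in_y:
  "to_fract (in_y (\<Prod>a\<leftarrow>as. [:- a, 1:])) = (\<Prod>a\<leftarrow>as. varY - scalar a)"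
proof (induction as)
  case Nil
  have "in_y 1 = 1" by (rule poly_eqI) (simp add: in_y_def coeff_map_poly coeff_1)
  then show ?case by simp
next
  case (Cons a as)
  have "in_y [:- a, 1:] = [:- [:a:], 1:]" by (simp add: in_y_def map_poly_pCons flip: one_pCons)
  then have "to_fract (in_y [:- a, 1:]) = varY - scalar a" unfolding varY_minus_scalar by simp
  then show ?case using Cons by (simp only: list.map prod_list.Cons in_y_mult to_fract_mult)
qed

lemma squarefree_splits_roots:
  fixes q :: "'a::field poly"
  assumes "lead_coeff q = 1" "squarefree q" "splits q"
  obtains as where "q = (\<Prod>a\<leftarrow>as. [:- a, 1:])" "distinct as" "length as = degree q"
proof -
  obtain as where q: "q = (\<Prod>a\<leftarrow>as. [:- a, 1:])"
    using assms unfolding splits_def by auto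
  have "distinct as"
  proof (rule ccontr)
    assume "\<not> distinct as"
    \<comment> \<open>A repeated root would put the square of a linear factor into
      \<open>q\<close>.\<close>
    then obtain xs ys zs a where as: "as = xs @ [a] @ ys @ [a] @ zs"
      using not_distinct_decomp by blast
    let ?P = "\<lambda>us. \<Prod>a\<leftarrow>us. [:- a, 1:]"
    have "q = [:- a, 1:]\<^sup>2 * (?P xs * ?P ys * ?P zs)"
      unfolding q as by (simp only: list.map map_append prod_list.append prod_list.Cons
          prod_list.Nil power2_eq_square mult_1_left mult_1_right mult_ac)
    then have "[:- a, 1:]\<^sup>2 dvd q" by (rule dvdI)
    then have "[:- a, 1:] dvd 1" using assms(2) unfolding squarefree_def by blast
    then show False using prime_elem_linear[of a] by (simp add: prime_elem_def)
  qed
  moreover have "length as = degree q"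
    unfolding q by (rule degree_linear_factors[symmetric])
  ultimately show ?thesis using q that by simp
qed

subsection \<open>Poisson isomorphisms restrict to the polynomial ring\<close>

text \<open>Scalars and variables generate the polynomial ring, by Horner's scheme in
  \<open>y\<close> and then in \<open>x\<close>. The rule speaks of images under
  \<open>to_fract\<close> because the isomorphisms act on fractions.\<close>

lemma bivar_fract_induct [case_names scalar varX varY add mult]:
  assumes "\<And>c. P (scalar c)" "P varX" "P varY"
    and add: "\<And>u v. P u \<Longrightarrow> P v \<Longrightarrow> P (u + v)" and mult: "\<And>u v. P u \<Longrightarrow> P v \<Longrightarrow> P (u * v)"
  shows "P (to_fract p)"
proof -
  have inner: "P (to_fract [:q:])" for q
  proof (induction q)
    case 0
    then show ?case using assms(1)[of 0] by (simp add: scalar_0)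
  next
    case (pCons a q)
    have "to_fract [:pCons a q:] = scalar a + varX * to_fract [:q:]"
      by (simp add: scalar_def varX_def flip: to_fract_add to_fract_mult)
    then show ?case using pCons assms by metis
  qed
  show ?thesis
  proof (induction p)
    case 0
    then show ?case using assms(1)[of 0] by (simp add: scalar_0)
  next
    case (pCons a q)
    have "to_fract (pCons a q) = to_fract [:a:] + varY * to_fract q"
      by (simp add: varY_def flip: to_fract_add to_fract_mult)
    then show ?case using pCons inner assms by metis
  qed
qed

lemma poisson_field_isoD:
  assumes "poisson_field_iso f g \<phi>"
  shows "bij \<phi>" "\<phi> (u + v) = \<phi> u + \<phi> v" "\<phi> (u * v) = \<phi> u * \<phi> v" "\<phi> (scalar c) = scalar c"
    "\<phi> (poisson_bracket f u v) = poisson_bracket g (\<phi> u) (\<phi> v)"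
    "\<phi> 0 = 0" "\<phi> 1 = 1" "\<phi> (u - v) = \<phi> u - \<phi> v"
    "\<phi> (prod_list us) = prod_list (map \<phi> us)"
    "\<phi> u = \<phi> v \<longleftrightarrow> u = v"
proof -
  show *: "bij \<phi>" "\<phi> (u + v) = \<phi> u + \<phi> v" "\<phi> (u * v) = \<phi> u * \<phi> v" "\<phi> (scalar c) = scalar c"
    "\<phi> (poisson_bracket f u v) = poisson_bracket g (\<phi> u) (\<phi> v)" for u v c
    using assms unfolding poisson_field_iso_def by blast+
  show "\<phi> 0 = 0" using *(4)[of 0] by (simp add: scalar_0)
  show 1: "\<phi> 1 = 1" using *(4)[of 1] by (simp add: scalar_1)
  show "\<phi> (u - v) = \<phi> u - \<phi> v" using *(2)[of "u - v" v] by (simp add: algebra_simps)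
  show "\<phi> (prod_list us) = prod_list (map \<phi> us)"
    by (induction us) (simp_all add: 1 *(3))
  show "\<phi> u = \<phi> v \<longleftrightarrow> u = v" using *(1) by (auto dest: bij_is_inj injD)
qed

lemma poisson_field_iso_inv:
  assumes "poisson_field_iso f g \<phi>"
  shows "poisson_field_iso g f (inv_into UNIV \<phi>)"
proof -
  note i = poisson_field_isoD[OF assms]
  have s: "\<phi> (inv_into UNIV \<phi> u) = u" for u using i(1) by (simp add: bij_is_surj surj_f_inv_f)
  have inj: "u = v" if "\<phi> u = \<phi> v" for u v using that i(10) by blast
  show ?thesis
    unfolding poisson_field_iso_def
  proof (intro conjI allI)
    show "bij (inv_into UNIV \<phi>)" using i(1) by (rule bij_imp_bij_inv)
  qed (rule inj, simp add: i(2-5) s)+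
qed

text \<open>Both sides obey the same Horner recursion. This links an isomorphism to the substitution
  in the theorem.\<close>

lemma poisson_field_iso_eval2:
  assumes "poisson_field_iso f g \<phi>"
  shows "\<phi> (to_fract p) = eval2 p (\<phi> varX) (\<phi> varY)"
proof -
  note i = poisson_field_isoD[OF assms]
  have inner: "\<phi> (to_fract [:q:]) = poly (map_poly scalar q) (\<phi> varX)" for q
  proof (induction q)
    case 0
    then show ?case by (simp add: i)
  next
    case (pCons a q)
    have "to_fract [:pCons a q:] = scalar a + varX * to_fract [:q:]"
      by (simp add: scalar_def varX_def flip: to_fract_add to_fract_mult)
    then show ?case using pCons by (simp add: i map_poly_pCons scalar_0)
  qed
  show ?thesis
    unfolding eval2_def
  proof (induction p)
    case 0
    then show ?case by (simp add: i)
  next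
    case (pCons a q)
    have "to_fract (pCons a q) = to_fract [:a:] + varY * to_fract q"
      by (simp add: varY_def flip: to_fract_add to_fract_mult)
    then show ?case using pCons inner by (simp add: i map_poly_pCons)
  qed
qed

lemma poisson_bracket_eq_mult: "poisson_bracket f u v = poisson_bracket 1 u v * f"
  by (simp add: poisson_bracket_def)

lemma poisson_bracket_swap: "poisson_bracket f u v = - poisson_bracket f v u"
  by (simp add: poisson_bracket_def algebra_simps)

text \<open>Partial derivatives kill scalars, but each takes the value 1 at its own
  variable.\<close>

lemma vars_not_scalar: "varX \<noteq> scalar a" "varY \<noteq> scalar a"
  using derivation_overD(3)[OF derivation_partial_x, of a]
    derivation_overD(3)[OF derivation_partial_y, of a] partials_vars
  by (metis zero_neq_one)+

text \<open>Applying \<open>\<phi>\<close> to \<open>{x, y} = f\<close>, with \<open>f\<close> in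
  factored form, gives the equation required by
  \<open>jacobian_equation_imp_integral\<close>.\<close>

lemma poisson_field_iso_vars_integral:
  fixes f :: "'a::field bivar"
  assumes iso: "poisson_field_iso (to_fract f) (to_fract g) \<phi>"
    and f: "to_fract f = scalar \<gamma> * (\<Prod>a\<leftarrow>as. varX - scalar a) * (\<Prod>b\<leftarrow>bs. varY - scalar b)"
    and "\<gamma> \<noteq> 0" and len: "length as \<ge> 3" "length bs \<ge> 3" and dist: "distinct as" "distinct bs"
  shows "\<phi> varX \<in> range to_fract" "\<phi> varY \<in> range to_fract"
proof -
  note i = poisson_field_isoD[OF iso]
  have ne: "\<phi> varX \<noteq> scalar a" "\<phi> varY \<noteq> scalar a" for a
    using vars_not_scalar[of a] i(10)[of _ "scalar a"] i(4) by auto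
  have eq: "poisson_bracket (to_fract g) (\<phi> varX) (\<phi> varY) =
      scalar \<gamma> * (\<Prod>a\<leftarrow>as. \<phi> varX - scalar a) * (\<Prod>b\<leftarrow>bs. \<phi> varY - scalar b)"
    using i(5)[of varX varY] unfolding poisson_bracket_varX_varY f
    by (simp add: i(3,4,8,9) o_def)
  show "\<phi> varX \<in> range to_fract"
    by (rule jacobian_equation_imp_integral[OF eq]) (use assms ne in auto)
  \<comment> \<open>Skew symmetry exchanges the roles of the two images; the sign moves into the
    scalar.\<close>
  have "poisson_bracket (to_fract g) (\<phi> varY) (\<phi> varX) =
      scalar (- \<gamma>) * (\<Prod>b\<leftarrow>bs. \<phi> varY - scalar b) * (\<Prod>a\<leftarrow>as. \<phi> varX - scalar a)"
    unfolding poisson_bracket_swap[of _ "\<phi> varY"] eq by (simp add: scalar_uminus mult_ac)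
  then show "\<phi> varY \<in> range to_fract"
    by (rule jacobian_equation_imp_integral) (use assms ne in auto)
qed

lemma range_to_fract_closed:
  assumes "u \<in> range to_fract" "v \<in> range to_fract"
  shows "u + v \<in> range to_fract" "u * v \<in> range to_fract"
proof -
  obtain p q where uv: "u = to_fract p" "v = to_fract q" using assms by blast
  have "u + v = to_fract (p + q)" "u * v = to_fract (p * q)" by (simp_all add: uv)
  then show "u + v \<in> range to_fract" "u * v \<in> range to_fract" by (metis rangeI)+
qed

lemma poisson_field_iso_integral:
  assumes iso: "poisson_field_iso f g \<phi>"
    and "\<phi> varX \<in> range to_fract" "\<phi> varY \<in> range to_fract"
  shows "\<phi> (to_fract p) \<in> range to_fract"
proof (induction p rule: bivar_fract_induct)
  case (scalar c)
  show ?case using poisson_field_isoD(4)[OF iso, of c] unfolding scalar_def by auto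
qed (use assms in \<open>simp_all add: poisson_field_isoD[OF iso] range_to_fract_closed\<close>)

text \<open>With weight 1 the bracket is the Jacobian determinant. Its integrality lets the
  comparison of linear factors take place among polynomials.\<close>

lemma poisson_bracket_1_integral:
  assumes "u \<in> range to_fract" "v \<in> range to_fract"
  shows "poisson_bracket 1 u v \<in> range to_fract"
proof -
  obtain p q where "u = to_fract p" "v = to_fract q" using assms by blast
  then have "poisson_bracket 1 u v =
      to_fract (pderiv_x p * pderiv_y q - pderiv_y p * pderiv_x q)"
    by (simp add: poisson_bracket_def partial_x_to_fract partial_y_to_fract)
  then show ?thesis by blast
qed

lemma is_unit_bivar:
  fixes p :: "'a::field bivar"
  assumes "p dvd 1"
  obtains c where "p = [:[:c:]:]" "c \<noteq> 0"
proof -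
  obtain q where q: "p = [:q:]" "q dvd 1" using assms unfolding is_unit_poly_iff by blast
  then obtain c where "q = [:c:]" "c dvd 1" unfolding is_unit_poly_iff by blast
  then show ?thesis using that[of c] q by auto
qed

subsection \<open>Images of the linear factors\<close>

text \<open>The prime \<open>l\<close> divides the product of the preimages of the elements of
  \<open>M\<close>, hence one of these preimages. Applying \<open>\<phi>\<close>, the image of
  \<open>l\<close> is a nonunit divisor of the prime \<open>m\<close>, so the two are
  associated.\<close>

lemma image_of_prime_factor:
  fixes \<phi> :: "'a::field ratfun \<Rightarrow> 'a ratfun" and L M :: "'a bivar list"
  assumes iso: "poisson_field_iso f g \<phi>"
    and int: "\<And>p. \<phi> (to_fract p) \<in> range to_fract" "\<And>p. inv_into UNIV \<phi> (to_fract p) \<in> range to_fract"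
    and "inv_into UNIV \<phi> (scalar \<delta> * to_fract (prod_list M)) = to_fract j * to_fract (prod_list L)"
    and "\<delta> \<noteq> 0"
    and L: "\<And>l. l \<in> set L \<Longrightarrow> prime_elem l" and M: "\<And>m. m \<in> set M \<Longrightarrow> prime_elem m"
    and l: "l \<in> set L"
  obtains m c where "m \<in> set M" "c \<noteq> 0" "\<phi> (to_fract l) = scalar c * to_fract m"
proof -
  note i = poisson_field_isoD[OF iso]
  note i' = poisson_field_isoD[OF poisson_field_iso_inv[OF iso]]
  have s: "\<phi> (inv_into UNIV \<phi> u) = u" for u using i(1) by (simp add: bij_is_surj surj_f_inv_f)
  obtain k where k: "\<And>p. inv_into UNIV \<phi> (to_fract p) = to_fract (k p)"
  proof -
    have "\<forall>p. \<exists>q. inv_into UNIV \<phi> (to_fract p) = to_fract q" using int(2) by auto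
    then show ?thesis using that by metis
  qed
  have "inv_into UNIV \<phi> (to_fract (prod_list M)) = to_fract (prod_list (map k M))"
    unfolding to_fract_prod_list i'(9) by (simp add: k o_def)
  then have "scalar \<delta> * to_fract (prod_list (map k M)) = to_fract (j * prod_list L)"
    using assms(4) unfolding i'(3,4) by simp
  then have "[:[:\<delta>:]:] * prod_list (map k M) = j * prod_list L"
    unfolding scalar_def by (metis to_fract_eq_iff to_fract_mult)
  moreover have "l dvd j * prod_list L" using prod_list_dvd[OF l] by simp
  ultimately have "l dvd [:[:\<delta>:]:] * prod_list (map k M)" by simp
  moreover have "[:[:\<delta>:]:] dvd 1" using \<open>\<delta> \<noteq> 0\<close> by (simp add: is_unit_const_poly_iff dvd_field_iff)
  ultimately have "l dvd prod_list (map k M)"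
    using L[OF l] by (metis dvd_trans prime_elem_def)
  then obtain m where m: "m \<in> set M" "l dvd k m"
    using prime_elem_dvd_prod_list[OF L[OF l], of "map k M"] by auto
  then obtain h where h: "k m = l * h" by (elim dvdE)
  obtain r t where r: "\<phi> (to_fract l) = to_fract r" and t: "\<phi> (to_fract h) = to_fract t"
    using int(1) by blast
  have "to_fract m = \<phi> (to_fract (k m))" using s k by metis
  then have "to_fract m = to_fract (r * t)" by (simp add: h i r t)
  then have mrt: "m = r * t" by (simp only: to_fract_eq_iff)
  \<comment> \<open>Units are nonzero constants, which \<open>\<phi>\<close> fixes; by injectivity
    \<open>l\<close> itself would be a constant.\<close>
  have "\<not> r dvd 1"
  proof
    assume "r dvd 1"
    then obtain c where "r = [:[:c:]:]" "c \<noteq> 0" by (rule is_unit_bivar)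
    then have "\<phi> (to_fract l) = \<phi> (scalar c)" using r i(4) by (simp add: scalar_def)
    then have "l = [:[:c:]:]" unfolding i(10) by (simp add: scalar_def)
    then have "l dvd 1" using \<open>c \<noteq> 0\<close> by (simp add: is_unit_const_poly_iff dvd_field_iff)
    then show False using L[OF l] unfolding prime_elem_def by blast
  qed
  moreover have "irreducible m" using M[OF m(1)] by (rule prime_elem_imp_irreducible)
  ultimately have "t dvd 1" using mrt using irreducibleD by blast
  then obtain c where c: "t = [:[:c:]:]" "c \<noteq> 0" by (rule is_unit_bivar)
  have "\<phi> (to_fract l) = scalar (1 / c) * to_fract m"
  proof -
    have 1: "scalar (1 / c) * scalar c = 1" using c(2) by (simp flip: scalar_mult add: scalar_1)
    have "to_fract m = scalar c * to_fract r"
      unfolding mrt c(1) to_fract_mult scalar_def by (rule mult.commute)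
    then have "scalar (1 / c) * to_fract m = (scalar (1 / c) * scalar c) * to_fract r"
      by (simp only: mult.assoc)
    then show ?thesis unfolding r 1 by simp
  qed
  then show ?thesis using that[of m "1 / c"] m(1) c(2) by simp
qed


text \<open>Factors in \<open>x\<close> and in \<open>y\<close> share one list because an
  isomorphism may send a factor in one variable to a factor in the other.\<close>

definition linear_factors :: "'a::field list \<Rightarrow> 'a list \<Rightarrow> 'a bivar list" where
  "linear_factors as bs = map (\<lambda>a. [:[:- a, 1:]:]) as @ map (\<lambda>b. [:- [:b:], 1:]) bs"

lemma linear_factors_cases:
  assumes "l \<in> set (linear_factors as bs)"
  obtains a where "l = [:[:- a, 1:]:]" | b where "l = [:- [:b:], 1:]"
  using assms unfolding linear_factors_def set_append set_map by blast

lemma prime_elem_linear_factors: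
  assumes "l \<in> set (linear_factors as bs)"
  shows "prime_elem l"
  using assms
proof (cases rule: linear_factors_cases)
  case (1 a)
  show ?thesis unfolding 1 by (rule lift_prime_elem_poly[OF prime_elem_linear])
next
  case (2 b)
  show ?thesis unfolding 2 by (rule prime_elem_linear)
qed

lemma to_fract_linear_factor:
  assumes "l \<in> set (linear_factors as bs)"
  obtains v a where "v = varX \<or> v = varY" "to_fract l = v - scalar a"
  using assms
proof (cases rule: linear_factors_cases)
  case (1 a)
  show ?thesis by (rule that[of varX a]) (simp_all only: 1 varX_minus_scalar simp_thms)
next
  case (2 b)
  show ?thesis by (rule that[of varY b]) (simp_all only: 2 varY_minus_scalar simp_thms)
qed

lemma to_fract_prod_linear_factors:
  "to_fract (prod_list (linear_factors as bs)) =
     (\<Prod>a\<leftarrow>as. varX - scalar a) * (\<Prod>b\<leftarrow>bs. varY - scalar b)"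
  unfolding linear_factors_def to_fract_prod_list
  by (simp add: o_def varX_minus_scalar varY_minus_scalar)

text \<open>A single factor \<open>z - scalar a\<close> determines the image of \<open>z\<close>,
  since \<open>\<phi>\<close> fixes \<open>scalar a\<close>.\<close>

lemma image_of_variable:
  assumes img: "\<And>l. l \<in> set L \<Longrightarrow>
      \<exists>m c. m \<in> set (linear_factors as bs) \<and> c \<noteq> 0 \<and> \<phi> (to_fract l) = scalar c * to_fract m"
    and iso: "poisson_field_iso f g \<phi>" and l: "l \<in> set L" "to_fract l = z - scalar a"
  obtains v c d where "v = varX \<or> v = varY" "\<phi> z = scalar c * v + scalar d"
proof -
  note i = poisson_field_isoD[OF iso]
  obtain m c where m: "m \<in> set (linear_factors as bs)" "\<phi> (to_fract l) = scalar c * to_fract m"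
    using img[OF l(1)] by blast
  obtain v b where v: "v = varX \<or> v = varY" "to_fract m = v - scalar b"
    using m(1) by (rule to_fract_linear_factor)
  have "\<phi> z - scalar a = scalar c * (v - scalar b)" using m(2) unfolding l(2) v(2) i(4,8) .
  then have "\<phi> z = scalar c * v + scalar (a - c * b)"
    by (simp add: scalar_diff scalar_mult algebra_simps)
  then show ?thesis using that v(1) by blast
qed

section \<open>Affine changes of variables and the conclusion\<close>

lemma invertible_2:
  fixes c11 c12 c21 c22 :: "'a::field"
  assumes "c11 * c22 - c12 * c21 \<noteq> 0"
  obtains C :: "'a^2^2" where "invertible C"
    "C$1$1 = c11" "C$1$2 = c12" "C$2$1 = c21" "C$2$2 = c22"
proof -
  define C :: "'a^2^2" where
    "C = (\<chi> i j. if i = 1 then if j = 1 then c11 else c12 else if j = 1 then c21 else c22)"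
  have C: "C$1$1 = c11" "C$1$2 = c12" "C$2$1 = c21" "C$2$2 = c22"
    by (simp_all add: C_def)
  moreover have "invertible C" using assms by (simp add: invertible_det_nz det_2 C)
  ultimately show ?thesis using that by blast
qed

lemma bracket_of_affine:
  fixes c1 :: "'a::field"
  shows
  "poisson_bracket 1 (scalar c11 * varX + scalar c12 * varY + scalar c1)
     (scalar c21 * varX + scalar c22 * varY + scalar c2) = scalar (c11 * c22 - c12 * c21)"
proof -
  note dx = derivation_overD[OF derivation_partial_x] and dy = derivation_overD[OF derivation_partial_y]
  have "partial_x (scalar a * varX + scalar b * varY + scalar c) = scalar a" for a b c :: 'a
    unfolding dx partials_vars by simp
  moreover have "partial_y (scalar a * varX + scalar b * varY + scalar c) = scalar b" for a b c :: 'a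
    unfolding dy partials_vars by simp
  ultimately show ?thesis
    unfolding poisson_bracket_def scalar_diff scalar_mult by simp
qed

theorem corollary7p4:
  fixes \<gamma>1 \<gamma>2 :: "'a::field_char_0"
    and f1 f2 g1 g2 :: "'a poly"
    and f g :: "'a bivar"
  assumes "\<gamma>1 \<noteq> 0" and "\<gamma>2 \<noteq> 0"
    and "f = [:[:\<gamma>1:]:] * in_x f1 * in_y g1"
    and "g = [:[:\<gamma>2:]:] * in_x f2 * in_y g2"
    and "lead_coeff f1 = 1" and "lead_coeff f2 = 1" and "lead_coeff g1 = 1" and "lead_coeff g2 = 1"
    and "squarefree f1" and "squarefree f2" and "squarefree g1" and "squarefree g2"
    and "splits f1" and "splits f2" and "splits g1" and "splits g2"
    and "degree f1 \<ge> 3" and "degree f2 \<ge> 3" and "degree g1 \<ge> 3" and "degree g2 \<ge> 3"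
    and "poisson_field_isomorphic (to_fract f) (to_fract g)"
  shows "\<exists>(c1 :: 'a) (c2 :: 'a) (C :: 'a^2^2).
    invertible C \<and>
    to_fract g =
      eval2 f (scalar (C$1$1) * varX + scalar (C$1$2) * varY + scalar c1)
              (scalar (C$2$1) * varX + scalar (C$2$2) * varY + scalar c2)
      / scalar (C$1$1 * C$2$2 - C$1$2 * C$2$1)"
proof -
  obtain \<phi> where iso: "poisson_field_iso (to_fract f) (to_fract g) \<phi>"
    using assms(21) unfolding poisson_field_isomorphic_def by blast
  define \<psi> where "\<psi> = inv_into UNIV \<phi>"
  have iso': "poisson_field_iso (to_fract g) (to_fract f) \<psi>"
    unfolding \<psi>_def by (rule poisson_field_iso_inv[OF iso])
  note i = poisson_field_isoD[OF iso] and i' = poisson_field_isoD[OF iso']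
  have s: "\<phi> (\<psi> u) = u" for u
    using i(1) by (simp add: \<psi>_def bij_is_surj surj_f_inv_f)
  obtain as where as: "f1 = (\<Prod>a\<leftarrow>as. [:- a, 1:])" "distinct as" "length as = degree f1"
    using squarefree_splits_roots[OF assms(5,9,13)] .
  obtain bs where bs: "g1 = (\<Prod>a\<leftarrow>bs. [:- a, 1:])" "distinct bs" "length bs = degree g1"
    using squarefree_splits_roots[OF assms(7,11,15)] .
  obtain as' where as': "f2 = (\<Prod>a\<leftarrow>as'. [:- a, 1:])" "distinct as'" "length as' = degree f2"
    using squarefree_splits_roots[OF assms(6,10,14)] .
  obtain bs' where bs': "g2 = (\<Prod>a\<leftarrow>bs'. [:- a, 1:])" "distinct bs'" "length bs' = degree g2"
    using squarefree_splits_roots[OF assms(8,12,16)] .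
  have f: "to_fract f = scalar \<gamma>1 * (\<Prod>a\<leftarrow>as. varX - scalar a) * (\<Prod>b\<leftarrow>bs. varY - scalar b)"
    unfolding assms(3) as(1) bs(1) to_fract_mult to_fract_in_x to_fract_in_y scalar_def ..
  have g: "to_fract g = scalar \<gamma>2 * (\<Prod>a\<leftarrow>as'. varX - scalar a) * (\<Prod>b\<leftarrow>bs'. varY - scalar b)"
    unfolding assms(4) as'(1) bs'(1) to_fract_mult to_fract_in_x to_fract_in_y scalar_def ..
  have int: "\<phi> varX \<in> range to_fract" "\<phi> varY \<in> range to_fract"
    by (rule poisson_field_iso_vars_integral[OF iso f assms(1)];
        simp only: as(2,3) bs(2,3) assms(17,19))+
  have int': "\<psi> varX \<in> range to_fract" "\<psi> varY \<in> range to_fract"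
    by (rule poisson_field_iso_vars_integral[OF iso' g assms(2)];
        simp only: as'(2,3) bs'(2,3) assms(18,20))+
  define J where "J = poisson_bracket 1 (\<phi> varX) (\<phi> varY)"
  define J' where "J' = poisson_bracket 1 (\<psi> varX) (\<psi> varY)"
  obtain j' where j': "J' = to_fract j'"
    using poisson_bracket_1_integral[OF int'] unfolding J'_def by blast
  \<comment> \<open>Since \<open>f\<close> is the bracket of the variables, its image is the bracket
    of their images with respect to \<open>g\<close>.\<close>
  have \<phi>f: "\<phi> (to_fract f) = J * to_fract g"
    using i(5)[of varX varY] poisson_bracket_eq_mult[of "to_fract g" "\<phi> varX" "\<phi> varY"]
    unfolding J_def by (simp add: poisson_bracket_varX_varY)
  have \<psi>g: "\<psi> (to_fract g) = J' * to_fract f"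
    using i'(5)[of varX varY] poisson_bracket_eq_mult[of "to_fract f" "\<psi> varX" "\<psi> varY"]
    unfolding J'_def by (simp add: poisson_bracket_varX_varY)
  have "to_fract f \<noteq> 0"
    unfolding f using assms(1) by (auto simp: prod_list_zero_iff scalar_eq_0_iff vars_not_scalar)
  then have "J * to_fract g \<noteq> 0" using i(10)[of "to_fract f" 0] unfolding \<phi>f i(6) by blast
  then have "J \<noteq> 0" by auto
  let ?L = "linear_factors as bs" and ?M = "linear_factors as' bs'"
  have "\<psi> (to_fract g) = J' * scalar \<gamma>1 * to_fract (prod_list ?L)"
    unfolding \<psi>g f to_fract_prod_linear_factors by (simp only: mult.assoc)
  \<comment> \<open>The polynomial Jacobian \<open>j'\<close> of the inverse and
    \<open>\<gamma>1\<close> together form the cofactor of \<open>prod_list ?L\<close>.\<close>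
  then have \<psi>M: "\<psi> (scalar \<gamma>2 * to_fract (prod_list ?M)) =
      to_fract (j' * [:[:\<gamma>1:]:]) * to_fract (prod_list ?L)"
    unfolding g to_fract_prod_linear_factors j' scalar_def to_fract_mult by (simp only: mult.assoc)
  have img: "\<exists>m c. m \<in> set ?M \<and> c \<noteq> 0 \<and> \<phi> (to_fract l) = scalar c * to_fract m"
    if l: "l \<in> set ?L" for l
  proof -
    note primes = prime_elem_linear_factors[of _ as bs] prime_elem_linear_factors[of _ as' bs']
    obtain m c where "m \<in> set ?M" "c \<noteq> 0" "\<phi> (to_fract l) = scalar c * to_fract m"
      using image_of_prime_factor[OF iso poisson_field_iso_integral[OF iso int]
          poisson_field_iso_integral[OF iso' int', unfolded \<psi>_def] \<psi>M[unfolded \<psi>_def]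
          assms(2) primes l] .
    then show ?thesis by blast
  qed
  have "as \<noteq> []" "bs \<noteq> []" using as(3) bs(3) assms(17,19) by auto
  then have mem: "[:[:- hd as, 1:]:] \<in> set ?L" "[:- [:hd bs:], 1:] \<in> set ?L"
    unfolding linear_factors_def by auto
  obtain v c d where X: "v = varX \<or> v = varY" "\<phi> varX = scalar c * v + scalar d"
    by (rule image_of_variable[OF img iso mem(1) varX_minus_scalar[symmetric]])
  obtain v' c' d' where Y: "v' = varX \<or> v' = varY" "\<phi> varY = scalar c' * v' + scalar d'"
    by (rule image_of_variable[OF img iso mem(2) varY_minus_scalar[symmetric]])
  \<comment> \<open>One of the two coefficients is 0. The general form covers the case where
    variables are kept and the case where they are swapped.\<close>
  obtain c11 c12 where X': "\<phi> varX = scalar c11 * varX + scalar c12 * varY + scalar d"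
    using X by (metis add.commute add.right_neutral mult_zero_left scalar_0)
  obtain c21 c22 where Y': "\<phi> varY = scalar c21 * varX + scalar c22 * varY + scalar d'"
    using Y by (metis add.commute add.right_neutral mult_zero_left scalar_0)
  \<comment> \<open>So \<open>J\<close> is constant, and \<open>J \<noteq> 0\<close> makes the
    matrix invertible.\<close>
  have J: "J = scalar (c11 * c22 - c12 * c21)"
    unfolding J_def X' Y' by (rule bracket_of_affine)
  then have "c11 * c22 - c12 * c21 \<noteq> 0" using \<open>J \<noteq> 0\<close> by (metis scalar_0)
  then obtain C :: "'a^2^2" where C: "invertible C"
    "C$1$1 = c11" "C$1$2 = c12" "C$2$1 = c21" "C$2$2 = c22"
    by (rule invertible_2)
  \<comment> \<open>The image of \<open>f\<close> under \<open>\<phi>\<close> is \<open>f\<close>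
    with the affine forms substituted, so solving \<open>\<phi>f\<close> for \<open>g\<close> gives
    the claim.\<close>
  have "to_fract g = \<phi> (to_fract f) / J" using \<phi>f \<open>J \<noteq> 0\<close> by simp
  then have "to_fract g = eval2 f (scalar c11 * varX + scalar c12 * varY + scalar d)
      (scalar c21 * varX + scalar c22 * varY + scalar d') / scalar (c11 * c22 - c12 * c21)"
    unfolding poisson_field_iso_eval2[OF iso] X' Y' J .
  then show ?thesis using C by metis
qed

end
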